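(* Let $A$ be a subgroup of a group $G$ and let $W$ be a subgroup of a finitely generated group $F$ whose commutator subgroup $F'$ has infinite index in $F$. Then the number of homomorphisms $\varphi: F\to G$ such that $\varphi(W)=A$ is divisible by $|A'|$, the order of the commutator subgroup of $A$.
   Context: Groups need not be finite; divisibility is understood in the sense of cardinal arithmetic: an infinite cardinal is divisible by every nonzero cardinal not exceeding it. *)

theory Defs
  imports "HOL-Algebra.Algebra" "HOL-Library.Equipollence"
begin

text \<open>Cardinal divisibility: the cardinality of M is divisible by that of B,
  i.e. |M| = |B| * |C| for some cardinal |C| (C may be taken in the type of M).\<close>
definition card_dvd :: "'b set \<Rightarrow> 'a set \<Rightarrow> bool" where
  "card_dvd B M \<longleftrightarrow> (\<exists>C :: 'a set. eqpoll M (Sigma B (\<lambda>_. C)))"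

definition finitely_generated :: "('a, 'b) monoid_scheme \<Rightarrow> bool" where
  "finitely_generated F \<longleftrightarrow> (\<exists>S. finite S \<and> S \<subseteq> carrier F \<and> generate F S = carrier F)"

text \<open>Homomorphisms F \<rightarrow> G, identified with their restriction to carrier F.\<close>
definition homs_onto :: "('a, 'c) monoid_scheme \<Rightarrow> ('b, 'd) monoid_scheme \<Rightarrow> 'a set \<Rightarrow> 'b set \<Rightarrow> ('a \<Rightarrow> 'b) set" where
  "homs_onto F G W A = {\<phi>. \<phi> \<in> hom F G \<and> \<phi> \<in> extensional (carrier F) \<and> \<phi> ` W = A}"

end

(* Since F/F' is infinite and finitely generated, F has an epimorphism d onto the integers: adjoin
   the generators of the abelianization one at a time; if s^m falls into the subgroup B built so
   far, extend a map on B by y |-> d(y^m), otherwise read off the exponent of s.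

   Let K = ker d, d(t) = 1 and H = A'. For a homomorphism phi let core(phi) be the largest subgroup
   of H normalized by phi(F) and centralizing phi(K). For c in core(phi) there is exactly one
   homomorphism that agrees with phi on K and sends t to phi(t)c; these form the fiber of phi, and
   fibers partition the homomorphisms. H permutes the fibers by conjugation, and the stabilizer of
   the fiber of phi is core(phi). So the union of an H-orbit of fibers has
   |H : core(phi)| |core(phi)| = |H| elements. Finally the condition phi(W) = A is preserved by
   both moves, as W' lies in K and core(phi) in A'. *)

theory Submission
  imports Defs
begin

text \<open>With \<open>m_assoc\<close> nesting products to the right, this rule and the next let
  the simplifier cancel a factor against its inverse deep inside a group word.\<close>

lemma (in group) inv_cancel_left:
  "\<lbrakk>a \<in> carrier G; b \<in> carrier G\<rbrakk> \<Longrightarrow> inv a \<otimes> (a \<otimes> b) = b"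
  by (simp flip: m_assoc)

lemma (in group) inv_cancel_right:
  "\<lbrakk>a \<in> carrier G; b \<in> carrier G\<rbrakk> \<Longrightarrow> a \<otimes> (inv a \<otimes> b) = b"
  by (simp flip: m_assoc)

section \<open>Degree maps\<close>

lemma (in comm_group) int_pow_mult_mult:
  assumes "s \<in> carrier G" "b \<in> carrier G" "c \<in> carrier G"
  shows "s [^] (i::int) \<otimes> b \<otimes> (s [^] (j::int) \<otimes> c) = s [^] (i + j) \<otimes> (b \<otimes> c)"
proof -
  have "b \<otimes> (s [^] j \<otimes> c) = s [^] j \<otimes> (b \<otimes> c)"
    using assms by (intro m_lcomm) auto
  then show ?thesis using assms by (simp add: int_pow_mult m_assoc)
qed

text \<open>By commutativity all powers of \<open>s\<close> can be collected in front.\<close>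

lemma (in comm_group) generate_insert_incl:
  assumes "s \<in> carrier G" "T \<subseteq> carrier G" "x \<in> generate G (insert s T)"
  shows "\<exists>(i::int). \<exists>b\<in>generate G T. x = s [^] i \<otimes> b"
  using assms(3)
proof (induction rule: generate.induct)
  case one
  have "\<one> = s [^] (0::int) \<otimes> \<one>" by simp
  then show ?case using generate.one by blast
next
  case (incl h)
  show ?case
  proof (cases "h = s")
    case True
    then have "h = s [^] (1::int) \<otimes> \<one>" using assms(1) by simp
    then show ?thesis using generate.one by blast
  next
    case False
    then have "h \<in> T" using incl by blast
    moreover then have "h = s [^] (0::int) \<otimes> h" using assms(2) by auto
    ultimately show ?thesis using generate.incl by metis
  qed
next
  case (inv h)
  show ?case
  proof (cases "h = s")
    case True
    then have "inv h = s [^] (- 1::int) \<otimes> \<one>" using assms(1) by (simp add: int_pow_neg)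
    then show ?thesis using generate.one by blast
  next
    case False
    then have "h \<in> T" using inv by blast
    moreover then have "inv h = s [^] (0::int) \<otimes> inv h" using assms(2) by auto
    ultimately show ?thesis using generate.inv by metis
  qed
next
  case (eng h1 h2)
  then obtain i j :: int and b c where
    *: "b \<in> generate G T" "h1 = s [^] i \<otimes> b" "c \<in> generate G T" "h2 = s [^] j \<otimes> c"
    by blast
  have "b \<in> carrier G" "c \<in> carrier G"
    using * generate_in_carrier assms(2) by blast+
  then have "h1 \<otimes> h2 = s [^] (i + j) \<otimes> (b \<otimes> c)"
    unfolding *(2,4) by (intro int_pow_mult_mult assms(1))
  moreover have "b \<otimes> c \<in> generate G T" using *(1,3) by (rule generate.eng)
  ultimately show ?case by blast
qed

text \<open>The claim asks for a nonzero value and not for the value 1, because extending a map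
  along y |-> y^m multiplies its old values by m. \<open>normalize_degree\<close> repairs this
  afterwards.\<close>

lemma (in comm_group) infinite_generate_nonzero_degree:
  assumes "finite T" "T \<subseteq> carrier G" "infinite (generate G T)"
  shows "\<exists>d. (\<forall>x\<in>generate G T. \<forall>y\<in>generate G T. d (x \<otimes> y) = d x + d y) \<and>
    (\<exists>x\<in>generate G T. d x \<noteq> (0::int))"
  using assms
proof (induction T rule: finite_induct)
  case empty
  then show ?case by (simp add: generate_empty)
next
  case (insert s T)
  let ?B = "generate G T" and ?C = "generate G (insert s T)"
  have s: "s \<in> carrier G" and T: "T \<subseteq> carrier G" using insert by auto
  interpret B: subgroup ?B G by (rule generate_is_subgroup[OF T])
  have Cc: "x \<in> carrier G" if "x \<in> ?C" for x
    using that generate_in_carrier insert.prems by blast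
  have BC: "?B \<subseteq> ?C" by (rule mono_generate) auto
  have sC: "s \<in> ?C" by (rule generate.incl) simp
  have rep: "\<exists>(i::int). \<exists>b\<in>?B. x = s [^] i \<otimes> b" if "x \<in> ?C" for x
    using generate_insert_incl[OF s T that] .
  show ?case
  proof (cases "\<exists>m::int. m > 0 \<and> s [^] m \<in> ?B")
    \<comment> \<open>No nontrivial power of \<open>s\<close> meets \<open>?B\<close>, so
      \<open>?C\<close> is the direct product of \<open>?B\<close> and an infinite cyclic group, and
      the exponent of \<open>s\<close> is a degree.\<close>
    case False
    have neg: "s [^] k \<notin> ?B" if "k \<noteq> 0" for k :: int
    proof
      assume k: "s [^] k \<in> ?B"
      then have "s [^] (- k) \<in> ?B" using s by (simp add: int_pow_neg)
      with k False that show False by (metis neg_0_less_iff_less not_less_iff_gr_or_eq)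
    qed
    have unique: "i = j" if "s [^] i \<otimes> b = s [^] j \<otimes> c" "b \<in> ?B" "c \<in> ?B" for i j :: int and b c
    proof -
      have [simp]: "b \<in> carrier G" "c \<in> carrier G" using that by auto
      have "s [^] (i - j) = (s [^] i \<otimes> b) \<otimes> (inv b \<otimes> inv (s [^] j))"
        using s by (simp add: int_pow_diff m_assoc inv_cancel_right)
      also have "\<dots> = (c \<otimes> s [^] j) \<otimes> (inv (s [^] j) \<otimes> inv b)"
        using s that(1) by (simp add: m_comm)
      also have "\<dots> = c \<otimes> inv b"
        using s by (simp add: m_assoc inv_cancel_right)
      finally have "s [^] (i - j) = c \<otimes> inv b" .
      then show ?thesis using neg[of "i - j"] that by auto
    qed
    define d where "d x = (THE i::int. \<exists>b\<in>?B. x = s [^] i \<otimes> b)" for x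
    have d: "d (s [^] i \<otimes> b) = i" if "b \<in> ?B" for i b
      unfolding d_def using that unique by (intro the_equality) blast+
    have "d (x \<otimes> y) = d x + d y" if xy: "x \<in> ?C" "y \<in> ?C" for x y
    proof -
      obtain i j :: int and b c where
        *: "b \<in> ?B" "x = s [^] i \<otimes> b" "c \<in> ?B" "y = s [^] j \<otimes> c"
        using rep xy by meson
      then have "x \<otimes> y = s [^] (i + j) \<otimes> (b \<otimes> c)"
        unfolding *(2,4) using *(1,3) s by (intro int_pow_mult_mult) auto
      then show ?thesis using * d by simp
    qed
    moreover have "d s = 1" using d[of \<one> 1] s by simp
    ultimately show ?thesis using sC by (intro exI[of _ d]) force
  next
    case True
    then obtain m :: int where m: "m > 0" "s [^] m \<in> ?B" by blast
    \<comment> \<open>\<open>?B\<close> has finite index in \<open>?C\<close>: multiples of m in the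
      exponent of \<open>s\<close> are absorbed into \<open>?B\<close>, which leaves the exponents
      0, ..., m - 1.\<close>
    have "infinite ?B"
    proof
      assume fin: "finite ?B"
      have "?C \<subseteq> (\<lambda>(i::int, b). s [^] i \<otimes> b) ` ({0..<m} \<times> ?B)"
      proof
        fix x assume "x \<in> ?C"
        then obtain i :: int and b where ib: "b \<in> ?B" "x = s [^] i \<otimes> b" using rep by meson
        have "s [^] i = s [^] (i mod m) \<otimes> (s [^] m) [^] (i div m)"
          using s by (simp add: int_pow_pow flip: int_pow_mult)
        then have "x = s [^] (i mod m) \<otimes> ((s [^] m) [^] (i div m) \<otimes> b)"
          using ib s by (simp add: m_assoc)
        moreover have "(s [^] m) [^] (i div m) \<otimes> b \<in> ?B"
          using ib m subgroup_int_pow_closed[OF B.subgroup_axioms] by simp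
        ultimately show "x \<in> (\<lambda>(i::int, b). s [^] i \<otimes> b) ` ({0..<m} \<times> ?B)"
          using m(1) by (intro image_eqI[of _ _ "(i mod m, _)"]) auto
      qed
      with fin insert.prems show False by (meson finite_SigmaI finite_atLeastLessThan_int finite_imageI finite_subset)
    qed
    then obtain d where d: "\<And>x y. x \<in> ?B \<Longrightarrow> y \<in> ?B \<Longrightarrow> d (x \<otimes> y) = d x + d y"
      and "\<exists>x\<in>?B. d x \<noteq> (0::int)"
      using insert.IH T by blast
    then obtain x where x: "x \<in> ?B" "d x \<noteq> 0" by blast
    \<comment> \<open>The m-th power map sends all of \<open>?C\<close> into \<open>?B\<close>, so
      the map from the induction hypothesis can be composed with it.\<close>
    have pow: "y [^] m \<in> ?B" if y: "y \<in> ?C" for y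
    proof -
      obtain i :: int and b where ib: "b \<in> ?B" "y = s [^] i \<otimes> b" using rep[OF y] by meson
      then have "y [^] m = (s [^] m) [^] i \<otimes> b [^] m"
        using s by (simp add: int_pow_distrib int_pow_pow mult.commute)
      then show ?thesis using ib m subgroup_int_pow_closed[OF B.subgroup_axioms] by simp
    qed
    \<comment> \<open>The composed map is nonzero at x, its value there being m * d x. As d is
      additive on \<open>?B\<close> only, this needs the powers of x to stay in
      \<open>?B\<close>.\<close>
    have "d (x [^] n) = int n * d x" for n :: nat
    proof (induction n)
      case 0
      have "d \<one> = d \<one> + d \<one>" using d[of \<one> \<one>] by simp
      then show ?case by simp
    next
      case (Suc n)
      have "x [^] n \<in> ?B"
        using subgroup_int_pow_closed[OF B.subgroup_axioms x(1), of "int n"] by (simp add: int_pow_int)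
      then show ?case using Suc d x by (simp add: algebra_simps)
    qed
    from this[of "nat m"] m(1) have "d (x [^] m) = m * d x"
      by (simp flip: int_pow_int)
    then have "d (x [^] m) \<noteq> 0" using m x by simp
    moreover have "d ((y \<otimes> z) [^] m) = d (y [^] m) + d (z [^] m)" if "y \<in> ?C" "z \<in> ?C" for y z
      using that pow d Cc by (simp add: int_pow_distrib)
    ultimately show ?thesis using x BC by (intro exI[of _ "\<lambda>y. d (y [^] m)"]) blast
  qed
qed

text \<open>The values of d are multiples of the least positive one; dividing by it keeps the map
  additive and makes 1 a value.\<close>

lemma (in group) normalize_degree:
  assumes d: "d \<in> hom G integer_group" and x: "x \<in> carrier G" "d x \<noteq> 0"
  shows "\<exists>e\<in>hom G integer_group. \<exists>t\<in>carrier G. e t = 1"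
proof -
  interpret d: group_hom G integer_group d
    using d by (simp add: group_hom_def group_hom_axioms_def)
  define P where "P n \<longleftrightarrow> n > 0 \<and> (\<exists>y\<in>carrier G. d y = int n)" for n
  \<comment> \<open>One of x and its inverse has positive degree.\<close>
  have "P (nat \<bar>d x\<bar>)"
  proof (cases "d x > 0")
    case True
    then show ?thesis using x by (auto simp: P_def)
  next
    case False
    then have "d (inv x) = int (nat \<bar>d x\<bar>)" using x by simp
    then show ?thesis using x unfolding P_def by (metis inv_closed zero_less_abs_iff zero_less_nat_eq)
  qed
  then have P: "P (LEAST n. P n)" by (rule LeastI)
  define g where "g = (LEAST n. P n)"
  obtain t where t: "t \<in> carrier G" "d t = int g" and g: "g > 0"
    using P unfolding g_def P_def by blast
  have dvd: "int g dvd d y" if y: "y \<in> carrier G" for y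
  proof (rule ccontr)
    assume "\<not> int g dvd d y"
    then have pos: "d y mod int g > 0" using g
      by (metis dvd_eq_mod_eq_0 of_nat_0_less_iff order_le_less pos_mod_sign)
    \<comment> \<open>The remainder modulo g is again a value of d, and a positive one would lie
      below the least positive value.\<close>
    have "d (y \<otimes> inv (t [^] (d y div int g))) = d y mod int g"
      using y t by (simp add: d.hom_int_pow minus_div_mult_eq_mod)
    then have "P (nat (d y mod int g))" unfolding P_def using pos y t
      by (intro conjI bexI[of _ "y \<otimes> inv (t [^] (d y div int g))"]) auto
    then have "g \<le> nat (d y mod int g)" unfolding g_def by (rule Least_le)
    moreover have "d y mod int g < int g" using g by simp
    ultimately show False using pos by linarith
  qed
  have "(\<lambda>y. d y div int g) \<in> hom G integer_group"
    using dvd by (auto intro!: homI simp: div_plus_div_distrib_dvd_left)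
  with t g show ?thesis by (metis div_self less_irrefl of_nat_eq_0_iff)
qed

text \<open>The abelianization is infinite and generated by the finitely many cosets of generators.
  Its degree map is composed with the projection and then normalized.\<close>

lemma (in group) infinite_abelianization_degree:
  assumes "finitely_generated G" "infinite (rcosets (derived G (carrier G)))"
  shows "\<exists>d\<in>hom G integer_group. \<exists>t\<in>carrier G. d t = 1"
proof -
  let ?D = "derived G (carrier G)"
  interpret D: normal ?D G by (rule derived_self_is_normal)
  interpret Q: comm_group "G Mod ?D" by (rule derived_quot_is_comm_group)
  interpret p: group_hom G "G Mod ?D" "\<lambda>a. ?D #> a"
    using D.r_coset_hom_Mod by (simp add: group_hom_def group_hom_axioms_def Q.is_group)
  obtain S where S: "finite S" "S \<subseteq> carrier G" "generate G S = carrier G"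
    using assms unfolding finitely_generated_def by blast
  let ?T = "(\<lambda>a. ?D #> a) ` S"
  have gen: "generate (G Mod ?D) ?T = carrier (G Mod ?D)"
    using p.generate_img[OF S(2)] S(3) by (simp add: carrier_FactGroup)
  have T: "?T \<subseteq> carrier (G Mod ?D)" using S(2) by auto
  obtain d where d: "\<And>x y. x \<in> carrier (G Mod ?D) \<Longrightarrow> y \<in> carrier (G Mod ?D) \<Longrightarrow>
      d (x \<otimes>\<^bsub>G Mod ?D\<^esub> y) = d x + d y"
    and "\<exists>x\<in>carrier (G Mod ?D). d x \<noteq> (0::int)"
    using Q.infinite_generate_nonzero_degree[OF _ T] S(1) assms(2)
    unfolding gen by (auto simp: FactGroup_def)
  then obtain x where x: "x \<in> carrier G" "d (?D #> x) \<noteq> 0" by (auto simp: carrier_FactGroup)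
  have "(\<lambda>a. d (?D #> a)) \<in> hom G integer_group"
    using d by (auto intro!: homI simp: D.rcos_sum[symmetric] carrier_FactGroup)
  then show ?thesis using normalize_degree x by blast
qed

section \<open>Cardinal divisibility from a partition into equipotent classes\<close>

lemma card_dvd_if_partition:
  assumes mem: "\<And>x. x \<in> M \<Longrightarrow> x \<in> R x" and sub: "\<And>x. x \<in> M \<Longrightarrow> R x \<subseteq> M"
    and eq: "\<And>x y. \<lbrakk>x \<in> M; y \<in> R x\<rbrakk> \<Longrightarrow> R y = R x"
    and poll: "\<And>x. x \<in> M \<Longrightarrow> B \<approx> R x"
  shows "card_dvd B M"
proof -
  obtain b where b: "\<And>x. x \<in> M \<Longrightarrow> bij_betw (b x) B (R x)"
    using poll unfolding eqpoll_def by metis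
  define rep where "rep x = (SOME y. y \<in> R x)" for x
  have rep: "rep x \<in> R x" if "x \<in> M" for x
    unfolding rep_def using mem[OF that] by (rule someI)
  have rep_M: "rep x \<in> M" and R_rep: "R (rep x) = R x" if "x \<in> M" for x
    using rep[OF that] sub eq that by blast+
  have rep_eq: "rep x = rep y" if "R x = R y" for x y
    using that by (simp add: rep_def)
  have "bij_betw (\<lambda>(h, x). b x h) (B \<times> rep ` M) M"
    unfolding bij_betw_def
  proof
    show "inj_on (\<lambda>(h, x). b x h) (B \<times> rep ` M)"
    proof (rule inj_onI, clarify)
      fix h x h' y
      assume h: "h \<in> B" "h' \<in> B" and xy: "x \<in> M" "y \<in> M" and e: "b (rep x) h = b (rep y) h'"
      have "b (rep x) h \<in> R x" "b (rep y) h' \<in> R y"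
        using b[OF rep_M] h xy R_rep by (auto dest!: bij_betwE)
      then have "R x = R y" using eq e xy by metis
      then have "rep x = rep y" by (rule rep_eq)
      with e b[OF rep_M[OF xy(1)]] h show "h = h' \<and> rep x = rep y"
        by (auto simp: bij_betw_def inj_on_def)
    qed
    have "x \<in> (\<lambda>(h, x). b x h) ` (B \<times> rep ` M)" if x: "x \<in> M" for x
    proof -
      have "x \<in> b (rep x) ` B"
        using b[OF rep_M[OF x]] mem[OF x] R_rep[OF x] by (simp add: bij_betw_def)
      with x show ?thesis by force
    qed
    moreover have "b (rep x) h \<in> M" if "x \<in> M" "h \<in> B" for x h
      using bij_betwE[OF b[OF rep_M[OF that(1)]]] that sub R_rep[OF that(1)] by blast
    ultimately show "(\<lambda>(h, x). b x h) ` (B \<times> rep ` M) = M" by auto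
  qed
  then have "B \<times> rep ` M \<approx> M" unfolding eqpoll_def by blast
  then show ?thesis unfolding card_dvd_def using eqpoll_sym by blast
qed

lemma (in group) inv_commute:
  assumes "h \<in> carrier G" "x \<in> carrier G" "h \<otimes> x = x \<otimes> h"
  shows "inv h \<otimes> x = x \<otimes> inv h"
proof -
  have "inv h \<otimes> x = inv h \<otimes> (x \<otimes> h) \<otimes> inv h"
    using assms(1,2) by (simp add: m_assoc)
  also have "\<dots> = inv h \<otimes> (h \<otimes> x) \<otimes> inv h"
    using assms(3) by simp
  also have "\<dots> = x \<otimes> inv h"
    using assms(1,2) by (simp add: inv_cancel_left)
  finally show ?thesis .
qed

section \<open>Twisting homomorphisms\<close>

text \<open>F is the semidirect product of the kernel of d and the infinite cyclic group generated
  by t. H is an arbitrary subgroup of G here and becomes A' only in the final theorem.\<close>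

locale twisting = G?: group G + F: group F
  for G :: "('g, 'c) monoid_scheme" (structure) and F :: "('f, 'd) monoid_scheme" +
  fixes d :: "'f \<Rightarrow> int" and t :: 'f and H :: "'g set"
  assumes degree: "d \<in> hom F integer_group"
    and t: "t \<in> carrier F" "d t = 1"
    and H: "subgroup H G"
begin

definition K :: "'f set" where
  "K = {k \<in> carrier F. d k = 0}"

definition homs :: "('f \<Rightarrow> 'g) set" where
  "homs = hom F G \<inter> extensional (carrier F)"

text \<open>The conjugates of h are only asked to lie in H; by \<open>core_conj_closed\<close> they
  lie in the core again, so the core is normalized by the image of \<phi>.\<close>

definition core :: "('f \<Rightarrow> 'g) \<Rightarrow> 'g set" where
  "core \<phi> = {h \<in> H. (\<forall>f\<in>carrier F. \<phi> f \<otimes> h \<otimes> inv \<phi> f \<in> H) \<and> (\<forall>k\<in>K. h \<otimes> \<phi> k = \<phi> k \<otimes> h)}"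

text \<open>The last condition ranges over all of F, which makes symmetry and transitivity direct.
  By \<open>fiberI\<close> its instance at t suffices.\<close>

definition fiber :: "('f \<Rightarrow> 'g) \<Rightarrow> ('f \<Rightarrow> 'g) set" where
  "fiber \<phi> = {\<psi> \<in> homs. (\<forall>k\<in>K. \<psi> k = \<phi> k) \<and> (\<forall>f\<in>carrier F. inv \<phi> f \<otimes> \<psi> f \<in> core \<phi>)}"

text \<open>The restriction keeps the result extensional, as membership in \<open>homs\<close>
  demands.\<close>

definition conj :: "'g \<Rightarrow> ('f \<Rightarrow> 'g) \<Rightarrow> 'f \<Rightarrow> 'g" where
  "conj a \<phi> = (\<lambda>f\<in>carrier F. a \<otimes> \<phi> f \<otimes> inv a)"

text \<open>The union of an H-orbit of fibers, since conjugation carries fibers to fibers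
  (\<open>conj_fiber\<close>).\<close>

definition block :: "('f \<Rightarrow> 'g) \<Rightarrow> ('f \<Rightarrow> 'g) set" where
  "block \<phi> = {conj a \<psi> | a \<psi>. a \<in> H \<and> \<psi> \<in> fiber \<phi>}"

sublocale d: group_hom F integer_group d
  using degree by (simp add: group_hom_def group_hom_axioms_def)

sublocale H: subgroup H G by (rule H)

section \<open>Homomorphisms and the splitting of F by degree\<close>

lemma group_hom_homs: "\<phi> \<in> homs \<Longrightarrow> group_hom F G \<phi>"
  by (simp add: homs_def group_hom_def group_hom_axioms_def)

lemma homs_closed [simp]: "\<phi> \<in> homs \<Longrightarrow> f \<in> carrier F \<Longrightarrow> \<phi> f \<in> carrier G"
  by (auto simp: homs_def hom_def)

lemma K_conj:
  assumes "k \<in> K" "f \<in> carrier F"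
  shows "f \<otimes>\<^bsub>F\<^esub> k \<otimes>\<^bsub>F\<^esub> inv\<^bsub>F\<^esub> f \<in> K"
  using assms by (simp add: K_def)

lemma K_subgroup: "subgroup K F"
  by (rule F.subgroupI) (auto simp: K_def)

lemma homs_extensional: "\<phi> \<in> homs \<Longrightarrow> \<phi> \<in> extensional (carrier F)"
  by (simp add: homs_def)

lemma degree_decomp:
  assumes "f \<in> carrier F"
  shows "f \<otimes>\<^bsub>F\<^esub> inv\<^bsub>F\<^esub> (t [^]\<^bsub>F\<^esub> d f) \<in> K"
    and "f \<otimes>\<^bsub>F\<^esub> inv\<^bsub>F\<^esub> (t [^]\<^bsub>F\<^esub> d f) \<otimes>\<^bsub>F\<^esub> t [^]\<^bsub>F\<^esub> d f = f"
  using assms t by (simp_all add: K_def d.hom_int_pow F.m_assoc)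

lemma K_carrier [simp]: "k \<in> K \<Longrightarrow> k \<in> carrier F"
  by (simp add: K_def)

text \<open>K and t generate F by \<open>degree_decomp\<close>.\<close>

lemma homs_eqI:
  assumes "\<phi> \<in> homs" "\<psi> \<in> homs" "\<And>k. k \<in> K \<Longrightarrow> \<phi> k = \<psi> k" "\<phi> t = \<psi> t"
  shows "\<phi> = \<psi>"
proof (rule extensionalityI)
  interpret \<phi>: group_hom F G \<phi> using assms(1) by (rule group_hom_homs)
  interpret \<psi>: group_hom F G \<psi> using assms(2) by (rule group_hom_homs)
  show "\<phi> \<in> extensional (carrier F)" "\<psi> \<in> extensional (carrier F)"
    using assms by (simp_all add: homs_extensional)
  fix f assume f: "f \<in> carrier F"
  note dc = degree_decomp[OF f]
  have "\<phi> f = \<phi> (f \<otimes>\<^bsub>F\<^esub> inv\<^bsub>F\<^esub> (t [^]\<^bsub>F\<^esub> d f)) \<otimes> \<phi> t [^] d f"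
    using dc f t by (metis F.int_pow_closed K_carrier \<phi>.hom_int_pow \<phi>.hom_mult)
  moreover have "\<psi> f = \<psi> (f \<otimes>\<^bsub>F\<^esub> inv\<^bsub>F\<^esub> (t [^]\<^bsub>F\<^esub> d f)) \<otimes> \<psi> t [^] d f"
    using dc f t by (metis F.int_pow_closed K_carrier \<psi>.hom_int_pow \<psi>.hom_mult)
  ultimately show "\<phi> f = \<psi> f" using assms(3)[OF dc(1)] assms(4) by simp
qed

section \<open>The core of a homomorphism\<close>

lemma core_commute: "h \<in> core \<phi> \<Longrightarrow> k \<in> K \<Longrightarrow> h \<otimes> \<phi> k = \<phi> k \<otimes> h"
  by (simp add: core_def)

lemma core_conj_H: "h \<in> core \<phi> \<Longrightarrow> f \<in> carrier F \<Longrightarrow> \<phi> f \<otimes> h \<otimes> inv \<phi> f \<in> H"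
  by (simp add: core_def)

lemma coreI:
  assumes "h \<in> H" "\<And>f. f \<in> carrier F \<Longrightarrow> \<phi> f \<otimes> h \<otimes> inv \<phi> f \<in> H"
    "\<And>k. k \<in> K \<Longrightarrow> h \<otimes> \<phi> k = \<phi> k \<otimes> h"
  shows "h \<in> core \<phi>"
  using assms by (simp add: core_def)

lemma core_H [simp]: "h \<in> core \<phi> \<Longrightarrow> h \<in> H"
  by (simp add: core_def)

lemma core_carrier [simp]: "h \<in> core \<phi> \<Longrightarrow> h \<in> carrier G"
  using core_H H.mem_carrier by blast

lemma core_subgroup:
  assumes \<phi>: "\<phi> \<in> homs"
  shows "subgroup (core \<phi>) G"
proof (rule subgroupI)
  show "core \<phi> \<subseteq> carrier G" by auto
  have "\<one> \<in> core \<phi>" using \<phi> by (intro coreI) auto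
  then show "core \<phi> \<noteq> {}" by blast
next
  fix h assume h: "h \<in> core \<phi>"
  show "inv h \<in> core \<phi>"
  proof (rule coreI)
    fix f assume f: "f \<in> carrier F"
    have "\<phi> f \<otimes> inv h \<otimes> inv \<phi> f = inv (\<phi> f \<otimes> h \<otimes> inv \<phi> f)"
      using f h \<phi> by (simp add: inv_mult_group m_assoc)
    then show "\<phi> f \<otimes> inv h \<otimes> inv \<phi> f \<in> H" using f h by (simp add: core_conj_H)
  qed (use h \<phi> in \<open>auto intro!: inv_commute simp: core_commute\<close>)
next
  fix h h' assume h: "h \<in> core \<phi>" "h' \<in> core \<phi>"
  show "h \<otimes> h' \<in> core \<phi>"
  proof (rule coreI)
    fix f assume f: "f \<in> carrier F"
    have "\<phi> f \<otimes> (h \<otimes> h') \<otimes> inv \<phi> f = (\<phi> f \<otimes> h \<otimes> inv \<phi> f) \<otimes> (\<phi> f \<otimes> h' \<otimes> inv \<phi> f)"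
      using f h \<phi> by (simp add: m_assoc inv_cancel_left)
    then show "\<phi> f \<otimes> (h \<otimes> h') \<otimes> inv \<phi> f \<in> H" using f h by (simp add: core_conj_H)
  next
    fix k assume k: "k \<in> K"
    have "h \<otimes> h' \<otimes> \<phi> k = h \<otimes> (\<phi> k \<otimes> h')"
      using h k \<phi> core_commute[OF h(2) k] by (simp add: m_assoc)
    also have "\<dots> = \<phi> k \<otimes> (h \<otimes> h')"
      using h k \<phi> core_commute[OF h(1) k] by (simp flip: m_assoc)
    finally show "h \<otimes> h' \<otimes> \<phi> k = \<phi> k \<otimes> (h \<otimes> h')" .
  qed (use h in simp)
qed

lemma core_conj_closed:
  assumes \<phi>: "\<phi> \<in> homs" and h: "h \<in> core \<phi>" and g: "g \<in> carrier F"
  shows "\<phi> g \<otimes> h \<otimes> inv \<phi> g \<in> core \<phi>"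
proof (rule coreI)
  interpret \<phi>: group_hom F G \<phi> using \<phi> by (rule group_hom_homs)
  show "\<phi> g \<otimes> h \<otimes> inv \<phi> g \<in> H" using h g by (simp add: core_conj_H)
  show "\<phi> f \<otimes> (\<phi> g \<otimes> h \<otimes> inv \<phi> g) \<otimes> inv \<phi> f \<in> H" if f: "f \<in> carrier F" for f
  proof -
    have "\<phi> f \<otimes> (\<phi> g \<otimes> h \<otimes> inv \<phi> g) \<otimes> inv \<phi> f = \<phi> (f \<otimes>\<^bsub>F\<^esub> g) \<otimes> h \<otimes> inv \<phi> (f \<otimes>\<^bsub>F\<^esub> g)"
      using f g h by (simp add: m_assoc inv_mult_group)
    then show ?thesis using f g h by (simp add: core_conj_H del: \<phi>.hom_mult)
  qed
  show "\<phi> g \<otimes> h \<otimes> inv \<phi> g \<otimes> \<phi> k = \<phi> k \<otimes> (\<phi> g \<otimes> h \<otimes> inv \<phi> g)" if k: "k \<in> K" for k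
  proof -
    \<comment> \<open>K is normal in F: commuting with \<phi> k after conjugation by \<phi> g
      amounts to commuting with the image of this conjugate of k before it.\<close>
    let ?k = "inv\<^bsub>F\<^esub> g \<otimes>\<^bsub>F\<^esub> k \<otimes>\<^bsub>F\<^esub> g"
    have "?k \<in> K" using K_conj[OF k F.inv_closed[OF g]] g by simp
    then have c: "h \<otimes> \<phi> ?k = \<phi> ?k \<otimes> h" using core_commute h by blast
    have "\<phi> g \<otimes> h \<otimes> inv \<phi> g \<otimes> \<phi> k = \<phi> g \<otimes> (h \<otimes> \<phi> ?k) \<otimes> inv \<phi> g"
      using g h k by (simp add: m_assoc)
    also have "\<dots> = \<phi> g \<otimes> (\<phi> ?k \<otimes> h) \<otimes> inv \<phi> g" unfolding c ..
    also have "\<dots> = \<phi> k \<otimes> (\<phi> g \<otimes> h \<otimes> inv \<phi> g)"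
      using g h k by (simp add: m_assoc inv_cancel_right)
    finally show ?thesis .
  qed
qed

lemma core_conj_closed':
  assumes "\<phi> \<in> homs" "h \<in> core \<phi>" "g \<in> carrier F"
  shows "inv \<phi> g \<otimes> h \<otimes> \<phi> g \<in> core \<phi>"
proof -
  interpret \<phi>: group_hom F G \<phi> using assms(1) by (rule group_hom_homs)
  show ?thesis using core_conj_closed[OF assms(1,2) F.inv_closed[OF assms(3)]] assms by simp
qed

section \<open>Fibers: equivalence and size\<close>

lemma fiber_homs: "\<psi> \<in> fiber \<phi> \<Longrightarrow> \<psi> \<in> homs"
  by (simp add: fiber_def)

lemma fiber_refl: "\<phi> \<in> homs \<Longrightarrow> \<phi> \<in> fiber \<phi>"
  by (simp add: fiber_def core_subgroup subgroup.one_closed)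

text \<open>The elements f satisfying the core condition form a subgroup, because the core is
  normalized by the image of \<phi>. It contains K, where the quotient is trivial, and t, hence all
  of F.\<close>

lemma fiberI:
  assumes \<phi>: "\<phi> \<in> homs" and \<psi>: "\<psi> \<in> homs" and k: "\<And>k. k \<in> K \<Longrightarrow> \<psi> k = \<phi> k"
    and c: "inv \<phi> t \<otimes> \<psi> t \<in> core \<phi>"
  shows "\<psi> \<in> fiber \<phi>"
proof -
  interpret \<phi>: group_hom F G \<phi> using \<phi> by (rule group_hom_homs)
  interpret \<psi>: group_hom F G \<psi> using \<psi> by (rule group_hom_homs)
  interpret N: subgroup "core \<phi>" G using \<phi> by (rule core_subgroup)
  let ?L = "{f \<in> carrier F. inv \<phi> f \<otimes> \<psi> f \<in> core \<phi>}"
  have L: "subgroup ?L F"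
  proof (rule F.subgroupI)
    show "?L \<noteq> {}" using t c by blast
  next
    fix f assume f: "f \<in> ?L"
    have "inv \<phi> (inv\<^bsub>F\<^esub> f) \<otimes> \<psi> (inv\<^bsub>F\<^esub> f) = \<phi> f \<otimes> inv (inv \<phi> f \<otimes> \<psi> f) \<otimes> inv \<phi> f"
      using f by (simp add: inv_mult_group m_assoc)
    moreover have "\<phi> f \<otimes> inv (inv \<phi> f \<otimes> \<psi> f) \<otimes> inv \<phi> f \<in> core \<phi>"
      using f by (intro core_conj_closed[OF \<phi>] N.m_inv_closed) auto
    ultimately show "inv\<^bsub>F\<^esub> f \<in> ?L" using f by simp
  next
    fix f g assume fg: "f \<in> ?L" "g \<in> ?L"
    have "inv \<phi> (f \<otimes>\<^bsub>F\<^esub> g) \<otimes> \<psi> (f \<otimes>\<^bsub>F\<^esub> g) =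
        (inv \<phi> g \<otimes> (inv \<phi> f \<otimes> \<psi> f) \<otimes> \<phi> g) \<otimes> (inv \<phi> g \<otimes> \<psi> g)"
      using fg by (simp add: inv_mult_group m_assoc inv_cancel_right)
    moreover have "inv \<phi> g \<otimes> (inv \<phi> f \<otimes> \<psi> f) \<otimes> \<phi> g \<in> core \<phi>"
      using fg by (intro core_conj_closed'[OF \<phi>]) auto
    ultimately show "f \<otimes>\<^bsub>F\<^esub> g \<in> ?L" using fg by simp
  qed auto
  have "f \<in> ?L" if f: "f \<in> carrier F" for f
  proof -
    have p: "t [^]\<^bsub>F\<^esub> d f \<in> ?L"
      using t c by (intro F.subgroup_int_pow_closed[OF L]) simp
    have "f \<otimes>\<^bsub>F\<^esub> inv\<^bsub>F\<^esub> (t [^]\<^bsub>F\<^esub> d f) \<in> ?L"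
      using degree_decomp(1)[OF f] k by simp
    from subgroup.m_closed[OF L this p] show ?thesis unfolding degree_decomp(2)[OF f] .
  qed
  then show ?thesis using \<psi> k by (simp add: fiber_def)
qed

text \<open>Since \<psi> f is \<phi> f times an element n of the core, conjugating by it means
  conjugating by n inside the core and then by \<phi> f. Only one inclusion is shown first:
  \<open>fiber_sym\<close> rests on it, and equality follows in \<open>fiber_core\<close>.\<close>

lemma fiber_core_subset:
  assumes \<phi>: "\<phi> \<in> homs" and \<psi>: "\<psi> \<in> fiber \<phi>"
  shows "core \<phi> \<subseteq> core \<psi>"
proof
  fix h assume h: "h \<in> core \<phi>"
  interpret N: subgroup "core \<phi>" G using \<phi> by (rule core_subgroup)
  have \<psi>h: "\<psi> \<in> homs" using \<psi> by (rule fiber_homs)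
  have "\<psi> f \<otimes> h \<otimes> inv \<psi> f \<in> H" if f: "f \<in> carrier F" for f
  proof -
    define n where "n = inv \<phi> f \<otimes> \<psi> f"
    have n: "n \<in> core \<phi>" using \<psi> f by (simp add: n_def fiber_def)
    have "\<psi> f = \<phi> f \<otimes> n" using f \<phi> \<psi>h by (simp add: n_def inv_cancel_right)
    then have "\<psi> f \<otimes> h \<otimes> inv \<psi> f = \<phi> f \<otimes> (n \<otimes> h \<otimes> inv n) \<otimes> inv \<phi> f"
      using f \<phi> h n by (simp add: inv_mult_group m_assoc)
    also have "\<dots> \<in> core \<phi>" using h n f by (intro core_conj_closed[OF \<phi>]) auto
    finally show ?thesis by simp
  qed
  then show "h \<in> core \<psi>" using h \<psi> by (intro coreI) (auto simp: core_commute fiber_def)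
qed

lemma fiber_sym:
  assumes \<phi>: "\<phi> \<in> homs" and \<psi>: "\<psi> \<in> fiber \<phi>"
  shows "\<phi> \<in> fiber \<psi>"
proof -
  have \<psi>h: "\<psi> \<in> homs" using \<psi> by (rule fiber_homs)
  have "inv \<psi> f \<otimes> \<phi> f \<in> core \<psi>" if f: "f \<in> carrier F" for f
  proof -
    have "inv (inv \<phi> f \<otimes> \<psi> f) \<in> core \<phi>"
      using \<psi> f subgroup.m_inv_closed[OF core_subgroup[OF \<phi>]] by (simp add: fiber_def)
    moreover have "inv (inv \<phi> f \<otimes> \<psi> f) = inv \<psi> f \<otimes> \<phi> f"
      using f \<phi> \<psi>h by (simp add: inv_mult_group)
    ultimately show ?thesis using fiber_core_subset[OF \<phi> \<psi>] by auto
  qed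
  then show ?thesis using \<phi> \<psi> by (simp add: fiber_def)
qed

lemma fiber_core:
  assumes "\<phi> \<in> homs" "\<psi> \<in> fiber \<phi>"
  shows "core \<psi> = core \<phi>"
  using fiber_core_subset fiber_sym fiber_homs assms by (meson subset_antisym)

lemma fiber_trans:
  assumes \<phi>: "\<phi> \<in> homs" and \<psi>: "\<psi> \<in> fiber \<phi>" and \<chi>: "\<chi> \<in> fiber \<psi>"
  shows "\<chi> \<in> fiber \<phi>"
proof -
  have h: "\<psi> \<in> homs" "\<chi> \<in> homs" using fiber_homs \<psi> \<chi> by auto
  have "inv \<phi> f \<otimes> \<chi> f \<in> core \<phi>" if f: "f \<in> carrier F" for f
  proof -
    have "inv \<phi> f \<otimes> \<chi> f = (inv \<phi> f \<otimes> \<psi> f) \<otimes> (inv \<psi> f \<otimes> \<chi> f)"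
      using f h \<phi> by (simp add: m_assoc inv_cancel_right)
    moreover have "inv \<phi> f \<otimes> \<psi> f \<in> core \<phi>" "inv \<psi> f \<otimes> \<chi> f \<in> core \<phi>"
      using f \<psi> \<chi> fiber_core[OF \<phi> \<psi>] by (auto simp: fiber_def)
    ultimately show ?thesis using subgroup.m_closed[OF core_subgroup[OF \<phi>]] by simp
  qed
  then show ?thesis using \<psi> \<chi> by (simp add: fiber_def)
qed

lemma fiber_eq:
  assumes "\<phi> \<in> homs" "\<psi> \<in> fiber \<phi>"
  shows "fiber \<psi> = fiber \<phi>"
  using assms fiber_trans fiber_sym fiber_homs by (meson subsetI subset_antisym)

text \<open>As c centralizes the image of K, \<phi> t and \<phi> t times c act on that image by the
  same conjugation. This is the compatibility needed to define a homomorphism on a semidirect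
  product.\<close>

lemma twist_exists:
  assumes \<phi>: "\<phi> \<in> homs" and c: "c \<in> carrier G" "\<And>k. k \<in> K \<Longrightarrow> c \<otimes> \<phi> k = \<phi> k \<otimes> c"
  shows "\<exists>\<psi>\<in>homs. (\<forall>k\<in>K. \<psi> k = \<phi> k) \<and> \<psi> t = \<phi> t \<otimes> c"
proof -
  interpret \<phi>: group_hom F G \<phi> using \<phi> by (rule group_hom_homs)
  define s where "s = \<phi> t \<otimes> c"
  have s [simp]: "s \<in> carrier G" using c t by (simp add: s_def)
  have up: "s \<otimes> \<phi> k = \<phi> (t \<otimes>\<^bsub>F\<^esub> k \<otimes>\<^bsub>F\<^esub> inv\<^bsub>F\<^esub> t) \<otimes> s" if k: "k \<in> K" for k
  proof -
    have "s \<otimes> \<phi> k = \<phi> t \<otimes> (c \<otimes> \<phi> k)" using c t k by (simp add: s_def m_assoc)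
    also have "\<dots> = \<phi> t \<otimes> (\<phi> k \<otimes> c)" using c(2)[OF k] by simp
    also have "\<dots> = \<phi> (t \<otimes>\<^bsub>F\<^esub> k \<otimes>\<^bsub>F\<^esub> inv\<^bsub>F\<^esub> t) \<otimes> s"
      using c t k by (simp add: s_def m_assoc inv_cancel_left)
    finally show ?thesis .
  qed
  \<comment> \<open>Negative powers need the inverse relation, obtained from \<open>up\<close> at
    the conjugate of k by the inverse of t.\<close>
  have down: "inv s \<otimes> \<phi> k = \<phi> (inv\<^bsub>F\<^esub> t \<otimes>\<^bsub>F\<^esub> k \<otimes>\<^bsub>F\<^esub> t) \<otimes> inv s" if k: "k \<in> K" for k
  proof -
    let ?k = "inv\<^bsub>F\<^esub> t \<otimes>\<^bsub>F\<^esub> k \<otimes>\<^bsub>F\<^esub> t"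
    have k': "?k \<in> K" using K_conj[OF k F.inv_closed[OF t(1)]] t by simp
    have "t \<otimes>\<^bsub>F\<^esub> ?k \<otimes>\<^bsub>F\<^esub> inv\<^bsub>F\<^esub> t = k"
      using t k by (simp add: F.m_assoc F.inv_cancel_right)
    then have "\<phi> k = s \<otimes> \<phi> ?k \<otimes> inv s"
      using up[OF k'] k k' by (simp add: m_assoc)
    then show ?thesis using k' by (simp add: m_assoc inv_cancel_left)
  qed
  \<comment> \<open>The quantifier over k stays inside the induction, since each step uses the
    hypothesis at a conjugate of k.\<close>
  have pow: "\<forall>k\<in>K. s [^] i \<otimes> \<phi> k = \<phi> (t [^]\<^bsub>F\<^esub> i \<otimes>\<^bsub>F\<^esub> k \<otimes>\<^bsub>F\<^esub> inv\<^bsub>F\<^esub> (t [^]\<^bsub>F\<^esub> i)) \<otimes> s [^] i" for i :: int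
  proof (induction i rule: int_induct[where k = 0])
    case base
    then show ?case by simp
  next
    case (step1 i)
    show ?case
    proof
      fix k assume k: "k \<in> K"
      let ?k = "t \<otimes>\<^bsub>F\<^esub> k \<otimes>\<^bsub>F\<^esub> inv\<^bsub>F\<^esub> t"
      have k': "?k \<in> K" using K_conj[OF k t(1)] .
      have "s [^] (i + 1) \<otimes> \<phi> k = s [^] i \<otimes> (s \<otimes> \<phi> k)"
        using k by (simp add: int_pow_mult m_assoc)
      also have "\<dots> = s [^] i \<otimes> \<phi> ?k \<otimes> s"
        unfolding up[OF k] using k' by (simp add: m_assoc del: \<phi>.hom_mult)
      also have "\<dots> = \<phi> (t [^]\<^bsub>F\<^esub> i \<otimes>\<^bsub>F\<^esub> ?k \<otimes>\<^bsub>F\<^esub> inv\<^bsub>F\<^esub> (t [^]\<^bsub>F\<^esub> i)) \<otimes> s [^] i \<otimes> s"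
        using step1(2) k' by (simp del: \<phi>.hom_mult)
      also have "t [^]\<^bsub>F\<^esub> i \<otimes>\<^bsub>F\<^esub> ?k \<otimes>\<^bsub>F\<^esub> inv\<^bsub>F\<^esub> (t [^]\<^bsub>F\<^esub> i) =
          t [^]\<^bsub>F\<^esub> (i + 1) \<otimes>\<^bsub>F\<^esub> k \<otimes>\<^bsub>F\<^esub> inv\<^bsub>F\<^esub> (t [^]\<^bsub>F\<^esub> (i + 1))"
        using t k by (simp add: F.int_pow_mult F.m_assoc F.inv_mult_group)
      finally show "s [^] (i + 1) \<otimes> \<phi> k =
          \<phi> (t [^]\<^bsub>F\<^esub> (i + 1) \<otimes>\<^bsub>F\<^esub> k \<otimes>\<^bsub>F\<^esub> inv\<^bsub>F\<^esub> (t [^]\<^bsub>F\<^esub> (i + 1))) \<otimes> s [^] (i + 1)"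
        using t k by (simp add: int_pow_mult m_assoc del: \<phi>.hom_mult)
    qed
  next
    case (step2 i)
    show ?case
    proof
      fix k assume k: "k \<in> K"
      let ?k = "inv\<^bsub>F\<^esub> t \<otimes>\<^bsub>F\<^esub> k \<otimes>\<^bsub>F\<^esub> t"
      have k': "?k \<in> K" using K_conj[OF k F.inv_closed[OF t(1)]] t by simp
      have "s [^] (i - 1) \<otimes> \<phi> k = s [^] i \<otimes> (inv s \<otimes> \<phi> k)"
        using k by (simp add: int_pow_diff m_assoc)
      also have "\<dots> = s [^] i \<otimes> \<phi> ?k \<otimes> inv s"
        unfolding down[OF k] using k' by (simp add: m_assoc del: \<phi>.hom_mult)
      also have "\<dots> = \<phi> (t [^]\<^bsub>F\<^esub> i \<otimes>\<^bsub>F\<^esub> ?k \<otimes>\<^bsub>F\<^esub> inv\<^bsub>F\<^esub> (t [^]\<^bsub>F\<^esub> i)) \<otimes> s [^] i \<otimes> inv s"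
        using step2(2) k' by (simp del: \<phi>.hom_mult)
      also have "t [^]\<^bsub>F\<^esub> i \<otimes>\<^bsub>F\<^esub> ?k \<otimes>\<^bsub>F\<^esub> inv\<^bsub>F\<^esub> (t [^]\<^bsub>F\<^esub> i) =
          t [^]\<^bsub>F\<^esub> (i - 1) \<otimes>\<^bsub>F\<^esub> k \<otimes>\<^bsub>F\<^esub> inv\<^bsub>F\<^esub> (t [^]\<^bsub>F\<^esub> (i - 1))"
        using t k by (simp add: F.int_pow_diff F.m_assoc F.inv_mult_group)
      finally show "s [^] (i - 1) \<otimes> \<phi> k =
          \<phi> (t [^]\<^bsub>F\<^esub> (i - 1) \<otimes>\<^bsub>F\<^esub> k \<otimes>\<^bsub>F\<^esub> inv\<^bsub>F\<^esub> (t [^]\<^bsub>F\<^esub> (i - 1))) \<otimes> s [^] (i - 1)"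
        using t k by (simp add: int_pow_diff m_assoc del: \<phi>.hom_mult)
    qed
  qed
  let ?r = "\<lambda>f. f \<otimes>\<^bsub>F\<^esub> inv\<^bsub>F\<^esub> (t [^]\<^bsub>F\<^esub> d f)"
  \<comment> \<open>The only possible choice: by \<open>degree_decomp\<close>, f is
    \<open>?r f\<close> times the power \<open>d f\<close> of t, and t is to be sent to s.\<close>
  define \<psi> where "\<psi> = (\<lambda>f\<in>carrier F. \<phi> (?r f) \<otimes> s [^] d f)"
  have "\<psi> (f \<otimes>\<^bsub>F\<^esub> g) = \<psi> f \<otimes> \<psi> g" if f: "f \<in> carrier F" and g: "g \<in> carrier F" for f g
  proof -
    have rg: "?r g \<in> K" and rf: "?r f \<in> K" using degree_decomp(1) f g by auto
    have cl [simp]: "t [^]\<^bsub>F\<^esub> d f \<otimes>\<^bsub>F\<^esub> ?r g \<otimes>\<^bsub>F\<^esub> inv\<^bsub>F\<^esub> (t [^]\<^bsub>F\<^esub> d f) \<in> carrier F"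
      using f g t by simp
    have "\<psi> f \<otimes> \<psi> g = \<phi> (?r f) \<otimes> (s [^] d f \<otimes> \<phi> (?r g)) \<otimes> s [^] d g"
      using f g rf rg by (simp add: \<psi>_def m_assoc del: \<phi>.hom_mult)
    also have "\<dots> = \<phi> (?r f) \<otimes> (\<phi> (t [^]\<^bsub>F\<^esub> d f \<otimes>\<^bsub>F\<^esub> ?r g \<otimes>\<^bsub>F\<^esub> inv\<^bsub>F\<^esub> (t [^]\<^bsub>F\<^esub> d f)) \<otimes> s [^] d f) \<otimes> s [^] d g"
      using pow[of "d f"] rg by (simp del: \<phi>.hom_mult)
    also have "\<dots> = \<phi> (?r f \<otimes>\<^bsub>F\<^esub> (t [^]\<^bsub>F\<^esub> d f \<otimes>\<^bsub>F\<^esub> ?r g \<otimes>\<^bsub>F\<^esub> inv\<^bsub>F\<^esub> (t [^]\<^bsub>F\<^esub> d f))) \<otimes> s [^] (d f + d g)"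
      unfolding \<phi>.hom_mult[OF K_carrier[OF rf] cl]
      using f g rf by (simp add: m_assoc int_pow_mult del: \<phi>.hom_mult)
    \<comment> \<open>The argument of \<phi> is now the K-part of the product, whose degree is d f +
      d g.\<close>
    also have "?r f \<otimes>\<^bsub>F\<^esub> (t [^]\<^bsub>F\<^esub> d f \<otimes>\<^bsub>F\<^esub> ?r g \<otimes>\<^bsub>F\<^esub> inv\<^bsub>F\<^esub> (t [^]\<^bsub>F\<^esub> d f)) =
        f \<otimes>\<^bsub>F\<^esub> g \<otimes>\<^bsub>F\<^esub> inv\<^bsub>F\<^esub> (t [^]\<^bsub>F\<^esub> (d f + d g))"
      unfolding F.int_pow_mult[OF t(1)]
      using f g t by (simp add: F.m_assoc F.inv_mult_group F.inv_cancel_left)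
    finally show ?thesis using f g by (simp add: \<psi>_def)
  qed
  then have "\<psi> \<in> homs"
    using t by (auto simp: homs_def \<psi>_def intro!: homI)
  moreover have "\<psi> k = \<phi> k" if "k \<in> K" for k
    using that by (simp add: \<psi>_def K_def del: K_carrier)
  moreover have "\<psi> t = \<phi> t \<otimes> c"
    using t c by (simp add: \<psi>_def) (simp add: s_def)
  ultimately show ?thesis by blast
qed

text \<open>Injectivity is \<open>homs_eqI\<close>. Every c in the core is reached by
  \<open>twist_exists\<close>, because the core centralizes the image of K.\<close>

lemma fiber_bij:
  assumes \<phi>: "\<phi> \<in> homs"
  shows "bij_betw (\<lambda>\<psi>. inv \<phi> t \<otimes> \<psi> t) (fiber \<phi>) (core \<phi>)"
  unfolding bij_betw_def
proof
  show "inj_on (\<lambda>\<psi>. inv \<phi> t \<otimes> \<psi> t) (fiber \<phi>)"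
  proof (rule inj_onI)
    fix \<psi> \<psi>' assume *: "\<psi> \<in> fiber \<phi>" "\<psi>' \<in> fiber \<phi>" "inv \<phi> t \<otimes> \<psi> t = inv \<phi> t \<otimes> \<psi>' t"
    then have h: "\<psi> \<in> homs" "\<psi>' \<in> homs" by (auto simp: fiber_def)
    then have "\<psi> t = \<psi>' t" using * \<phi> t by simp
    then show "\<psi> = \<psi>'" using * h by (intro homs_eqI) (auto simp: fiber_def)
  qed
  show "(\<lambda>\<psi>. inv \<phi> t \<otimes> \<psi> t) ` fiber \<phi> = core \<phi>"
  proof
    show "(\<lambda>\<psi>. inv \<phi> t \<otimes> \<psi> t) ` fiber \<phi> \<subseteq> core \<phi>" using t by (auto simp: fiber_def)
    show "core \<phi> \<subseteq> (\<lambda>\<psi>. inv \<phi> t \<otimes> \<psi> t) ` fiber \<phi>"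
    proof
      fix c assume c: "c \<in> core \<phi>"
      obtain \<psi> where \<psi>: "\<psi> \<in> homs" "\<And>k. k \<in> K \<Longrightarrow> \<psi> k = \<phi> k" "\<psi> t = \<phi> t \<otimes> c"
        using twist_exists[OF \<phi> core_carrier[OF c] core_commute[OF c]] by blast
      have e: "inv \<phi> t \<otimes> \<psi> t = c" using \<psi>(3) \<phi> t c by (simp add: inv_cancel_left)
      then have "\<psi> \<in> fiber \<phi>" using \<psi> c by (intro fiberI[OF \<phi>]) auto
      then show "c \<in> (\<lambda>\<psi>. inv \<phi> t \<otimes> \<psi> t) ` fiber \<phi>" using e by force
    qed
  qed
qed

section \<open>Conjugation by elements of H\<close>

lemma conj_homs:
  assumes "a \<in> carrier G" and \<phi>: "\<phi> \<in> homs"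
  shows "conj a \<phi> \<in> homs"
proof -
  interpret \<phi>: group_hom F G \<phi> using \<phi> by (rule group_hom_homs)
  show ?thesis using assms(1)
    by (auto simp: homs_def conj_def m_assoc inv_cancel_left intro!: homI)
qed

lemma conj_conj:
  assumes "a \<in> carrier G" "b \<in> carrier G" "\<phi> \<in> homs"
  shows "conj a (conj b \<phi>) = conj (a \<otimes> b) \<phi>"
  using assms by (auto simp: conj_def m_assoc inv_mult_group intro!: restrict_ext)

lemma conj_one: "\<phi> \<in> homs \<Longrightarrow> conj \<one> \<phi> = \<phi>"
  unfolding conj_def
  by (rule extensionalityI[of _ "carrier F"]) (auto simp: homs_extensional)

lemma conj_inv_conj:
  assumes "a \<in> carrier G" "\<phi> \<in> homs"
  shows "conj (inv a) (conj a \<phi>) = \<phi>" "conj a (conj (inv a) \<phi>) = \<phi>"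
  using assms by (simp_all add: conj_conj conj_one)

text \<open>Conjugation by a maps the core of \<phi> into that of \<open>conj a \<phi>\<close>; H is
  preserved because a lies in it.\<close>

lemma conj_fiber:
  assumes a: "a \<in> H" and \<phi>: "\<phi> \<in> homs" and \<psi>: "\<psi> \<in> fiber \<phi>"
  shows "conj a \<psi> \<in> fiber (conj a \<phi>)"
proof -
  have \<psi>h: "\<psi> \<in> homs" using \<psi> by (rule fiber_homs)
  have "a \<otimes> h \<otimes> inv a \<in> core (conj a \<phi>)" if h: "h \<in> core \<phi>" for h
  proof (rule coreI)
    show "a \<otimes> h \<otimes> inv a \<in> H" using a h by simp
    fix f assume f: "f \<in> carrier F"
    have "conj a \<phi> f \<otimes> (a \<otimes> h \<otimes> inv a) \<otimes> inv conj a \<phi> f = a \<otimes> (\<phi> f \<otimes> h \<otimes> inv \<phi> f) \<otimes> inv a"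
      using a h f \<phi> by (simp add: conj_def m_assoc inv_mult_group inv_cancel_left)
    also have "\<dots> \<in> H" using a h f by (simp add: core_conj_H)
    finally show "conj a \<phi> f \<otimes> (a \<otimes> h \<otimes> inv a) \<otimes> inv conj a \<phi> f \<in> H" .
  next
    fix k assume k: "k \<in> K"
    have "a \<otimes> h \<otimes> inv a \<otimes> conj a \<phi> k = a \<otimes> (h \<otimes> \<phi> k) \<otimes> inv a"
      using a h k \<phi> by (simp add: conj_def m_assoc inv_cancel_left)
    also have "\<dots> = a \<otimes> (\<phi> k \<otimes> h) \<otimes> inv a" using core_commute[OF h k] by simp
    also have "\<dots> = conj a \<phi> k \<otimes> (a \<otimes> h \<otimes> inv a)"
      using a h k \<phi> by (simp add: conj_def m_assoc inv_cancel_left)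
    finally show "a \<otimes> h \<otimes> inv a \<otimes> conj a \<phi> k = conj a \<phi> k \<otimes> (a \<otimes> h \<otimes> inv a)" .
  qed
  moreover have "inv conj a \<phi> f \<otimes> conj a \<psi> f = a \<otimes> (inv \<phi> f \<otimes> \<psi> f) \<otimes> inv a" if "f \<in> carrier F" for f
    using that a \<phi> \<psi>h by (simp add: conj_def m_assoc inv_mult_group inv_cancel_left)
  ultimately show ?thesis
    using \<psi> a conj_homs \<psi>h by (auto simp: fiber_def conj_def)
qed

text \<open>This identifies the stabilizer of a fiber. Agreement on K says that a centralizes the
  image of K, and the quotients of \<open>conj a \<phi>\<close> by \<phi> are, up to a factor in H,
  the conjugates of a.\<close>

lemma conj_fiber_iff:
  assumes a: "a \<in> H" and \<phi>: "\<phi> \<in> homs"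
  shows "conj a \<phi> \<in> fiber \<phi> \<longleftrightarrow> a \<in> core \<phi>"
proof
  interpret \<phi>: group_hom F G \<phi> using \<phi> by (rule group_hom_homs)
  interpret N: subgroup "core \<phi>" G using \<phi> by (rule core_subgroup)
  {
    assume c: "conj a \<phi> \<in> fiber \<phi>"
    have comm: "a \<otimes> \<phi> k = \<phi> k \<otimes> a" if k: "k \<in> K" for k
    proof -
      have "a \<otimes> \<phi> k \<otimes> inv a = \<phi> k" using c k by (auto simp: fiber_def conj_def)
      then have "a \<otimes> \<phi> k \<otimes> inv a \<otimes> a = \<phi> k \<otimes> a" by simp
      then show ?thesis using a k by (simp add: m_assoc)
    qed
    have "\<phi> f \<otimes> a \<otimes> inv \<phi> f \<in> H" if f: "f \<in> carrier F" for f
    proof -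
      \<comment> \<open>Taken at the inverse of f, the fiber condition yields the conjugate of a by
        \<phi> f itself.\<close>
      have "inv \<phi> (inv\<^bsub>F\<^esub> f) \<otimes> conj a \<phi> (inv\<^bsub>F\<^esub> f) \<in> H"
        using c F.inv_closed[OF f] unfolding fiber_def by (blast intro: core_H)
      then have "inv \<phi> (inv\<^bsub>F\<^esub> f) \<otimes> conj a \<phi> (inv\<^bsub>F\<^esub> f) \<otimes> a \<in> H"
        using a by simp
      moreover have "inv \<phi> (inv\<^bsub>F\<^esub> f) \<otimes> conj a \<phi> (inv\<^bsub>F\<^esub> f) \<otimes> a = \<phi> f \<otimes> a \<otimes> inv \<phi> f"
        using f a by (simp add: conj_def m_assoc)
      ultimately show ?thesis by simp
    qed
    then show "a \<in> core \<phi>" using a comm by (intro coreI)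
  next
    assume c: "a \<in> core \<phi>"
    show "conj a \<phi> \<in> fiber \<phi>"
    proof (rule fiberI[OF \<phi> conj_homs])
      show "conj a \<phi> k = \<phi> k" if k: "k \<in> K" for k
        using core_commute[OF c k] k a by (simp add: conj_def m_assoc)
      have "inv \<phi> t \<otimes> conj a \<phi> t = (inv \<phi> t \<otimes> a \<otimes> \<phi> t) \<otimes> inv a"
        using t a by (simp add: conj_def m_assoc)
      also have "\<dots> \<in> core \<phi>" using core_conj_closed'[OF \<phi> c t(1)] c by simp
      finally show "inv \<phi> t \<otimes> conj a \<phi> t \<in> core \<phi>" .
    qed (use a \<phi> in auto)
  }
qed

section \<open>Blocks: unions of H-orbits of fibers\<close>

lemma block_homs: "\<phi> \<in> homs \<Longrightarrow> block \<phi> \<subseteq> homs"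
  by (auto simp: block_def intro: conj_homs fiber_homs)

lemma block_refl: "\<phi> \<in> homs \<Longrightarrow> \<phi> \<in> block \<phi>"
  unfolding block_def using fiber_refl conj_one H.one_closed by (metis (mono_tags, lifting) mem_Collect_eq)

lemma block_sym:
  assumes \<phi>: "\<phi> \<in> homs" and "\<chi> \<in> block \<phi>"
  shows "\<phi> \<in> block \<chi>"
proof -
  obtain a \<psi> where *: "a \<in> H" "\<psi> \<in> fiber \<phi>" "\<chi> = conj a \<psi>"
    using assms(2) by (auto simp: block_def)
  have "conj a \<phi> \<in> fiber \<chi>"
    unfolding *(3) using fiber_sym[OF \<phi> *(2)] * by (intro conj_fiber) (auto intro: fiber_homs)
  moreover have "\<phi> = conj (inv a) (conj a \<phi>)" using * \<phi> by (simp add: conj_inv_conj)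
  ultimately show ?thesis using *(1) by (auto simp: block_def)
qed

lemma block_subset:
  assumes \<phi>: "\<phi> \<in> homs" and "\<chi> \<in> block \<phi>"
  shows "block \<chi> \<subseteq> block \<phi>"
proof
  obtain a \<psi> where *: "a \<in> H" "\<psi> \<in> fiber \<phi>" "\<chi> = conj a \<psi>"
    using assms(2) by (auto simp: block_def)
  fix \<omega> assume "\<omega> \<in> block \<chi>"
  then obtain b \<rho> where **: "b \<in> H" "\<rho> \<in> fiber \<chi>" "\<omega> = conj b \<rho>"
    by (auto simp: block_def)
  have \<psi>: "\<psi> \<in> homs" and \<rho>: "\<rho> \<in> homs" using * ** fiber_homs by auto
  have \<chi>: "\<chi> \<in> homs" using * \<psi> by (simp add: conj_homs)
  \<comment> \<open>Conjugating back by the inverse of a moves the fiber of \<chi> to that of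
    \<psi>, which is the fiber of \<phi>.\<close>
  have "conj (inv a) \<rho> \<in> fiber (conj (inv a) \<chi>)"
    using * ** \<chi> by (intro conj_fiber) auto
  also have "conj (inv a) \<chi> = \<psi>" using * \<psi> by (simp add: conj_inv_conj)
  also have "fiber \<psi> = fiber \<phi>" using \<phi> *(2) by (rule fiber_eq)
  finally have "conj (inv a) \<rho> \<in> fiber \<phi>" .
  moreover have "\<omega> = conj (b \<otimes> a) (conj (inv a) \<rho>)"
    using * ** \<rho> by (simp add: conj_homs conj_inv_conj flip: conj_conj)
  ultimately show "\<omega> \<in> block \<phi>" using * ** by (auto simp: block_def)
qed

lemma block_eq:
  assumes "\<phi> \<in> homs" "\<chi> \<in> block \<phi>"
  shows "block \<chi> = block \<phi>"
proof -
  have "\<chi> \<in> homs" using assms block_homs by blast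
  then show ?thesis using assms block_subset block_sym by (meson subset_antisym)
qed

text \<open>Orbit counting as an explicit bijection, valid for infinite H too: h is split into a
  coset representative modulo the core, which selects a conjugate fiber, and a core element, which
  selects a point of it.\<close>

lemma block_eqpoll:
  assumes \<phi>: "\<phi> \<in> homs"
  shows "H \<approx> block \<phi>"
proof -
  interpret N: subgroup "core \<phi>" G using \<phi> by (rule core_subgroup)
  define u where "u = inv_into (fiber \<phi>) (\<lambda>\<psi>. inv \<phi> t \<otimes> \<psi> t)"
  have u: "bij_betw u (core \<phi>) (fiber \<phi>)"
    unfolding u_def by (rule bij_betw_inv_into[OF fiber_bij[OF \<phi>]])
  have u_fiber: "u n \<in> fiber \<phi>" if "n \<in> core \<phi>" for n
    using u that by (auto dest: bij_betwE)
  \<comment> \<open>\<open>L h\<close> is the left coset of h modulo the core, and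
    \<open>r h\<close> is a representative that depends on this coset only.\<close>
  define L where "L h = {x \<in> H. inv x \<otimes> h \<in> core \<phi>}" for h
  define r where "r h = (SOME x. x \<in> L h)" for h
  have r: "r h \<in> H" "inv (r h) \<otimes> h \<in> core \<phi>" if "h \<in> H" for h
  proof -
    have "h \<in> L h" using that by (simp add: L_def)
    then have "r h \<in> L h" unfolding r_def by (rule someI)
    then show "r h \<in> H" "inv (r h) \<otimes> h \<in> core \<phi>" by (auto simp: L_def)
  qed
  have L_sub: "L h \<subseteq> L h'" if "h \<in> H" "h' \<in> H" "inv h \<otimes> h' \<in> core \<phi>" for h h'
  proof
    fix x assume x: "x \<in> L h"
    then have "inv x \<otimes> h' = (inv x \<otimes> h) \<otimes> (inv h \<otimes> h')"
      using that(1,2) by (simp add: L_def m_assoc inv_cancel_right)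
    then show "x \<in> L h'" using x that by (simp add: L_def)
  qed
  have r_eq: "r h = r h'" if h: "h \<in> H" "h' \<in> H" "inv h \<otimes> h' \<in> core \<phi>" for h h'
  proof -
    have "inv h' \<otimes> h = inv (inv h \<otimes> h')" using h(1,2) by (simp add: inv_mult_group)
    then have "inv h' \<otimes> h \<in> core \<phi>" using h by simp
    then have "L h = L h'" using L_sub h by blast
    then show ?thesis by (simp add: r_def)
  qed
  define \<beta> where "\<beta> h = conj (r h) (u (inv (r h) \<otimes> h))" for h
  have "bij_betw \<beta> H (block \<phi>)"
    unfolding bij_betw_def
  proof
    show "inj_on \<beta> H"
    proof (rule inj_onI)
      fix h h' assume h: "h \<in> H" "h' \<in> H" and e: "\<beta> h = \<beta> h'"
      define n n' where "n = inv (r h) \<otimes> h" and "n' = inv (r h') \<otimes> h'"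
      have n: "n \<in> core \<phi>" "n' \<in> core \<phi>" using r h by (auto simp: n_def n'_def)
      have hn: "h = r h \<otimes> n" "h' = r h' \<otimes> n'"
        using r(1) h by (simp_all add: n_def n'_def inv_cancel_right)
      have f: "u n \<in> fiber \<phi>" "u n' \<in> fiber \<phi>" using n u_fiber by auto
      then have fh: "u n \<in> homs" "u n' \<in> homs" using fiber_homs by auto
      have rh: "r h \<in> H" "r h' \<in> H" using r(1) h by auto
      have e': "conj (r h) (u n) = conj (r h') (u n')"
        using e by (simp add: \<beta>_def n_def n'_def)
      then have "conj (inv (r h')) (conj (r h) (u n)) = u n'"
        using fh rh by (simp add: conj_inv_conj)
      \<comment> \<open>The quotient of the representatives carries a member of the fiber into the
        same fiber, so it lies in the stabilizer, the core. Both cosets therefore coincide.\<close>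
      then have "conj (inv (r h') \<otimes> r h) (u n) \<in> fiber (u n)"
        using fh rh f fiber_eq[OF \<phi> f(1)] by (simp add: conj_conj)
      then have c: "inv (r h') \<otimes> r h \<in> core \<phi>"
        using conj_fiber_iff[of "inv (r h') \<otimes> r h" "u n"] rh fh fiber_core[OF \<phi> f(1)] by simp
      have "inv h' \<otimes> h = inv n' \<otimes> (inv (r h') \<otimes> r h) \<otimes> n"
        using rh n by (subst hn(1), subst hn(2)) (simp add: inv_mult_group m_assoc)
      also have "\<dots> \<in> core \<phi>" using n c by simp
      finally have rr: "r h = r h'" using r_eq h by metis
      then have "conj (inv (r h)) (conj (r h) (u n)) = conj (inv (r h)) (conj (r h) (u n'))"
        using e' by simp
      then have "u n = u n'" using fh rh by (simp add: conj_inv_conj)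
      then have "n = n'" using u n by (auto simp: bij_betw_def dest: inj_onD)
      then show "h = h'" using hn rr by simp
    qed
    show "\<beta> ` H = block \<phi>"
    proof
      show "\<beta> ` H \<subseteq> block \<phi>"
        unfolding \<beta>_def block_def using r u_fiber by blast
      show "block \<phi> \<subseteq> \<beta> ` H"
      proof
        fix \<chi> assume "\<chi> \<in> block \<phi>"
        then obtain a \<psi> where *: "a \<in> H" "\<psi> \<in> fiber \<phi>" "\<chi> = conj a \<psi>"
          by (auto simp: block_def)
        have \<psi>: "\<psi> \<in> homs" using * fiber_homs by auto
        define m where "m = inv (r a) \<otimes> a"
        have m: "m \<in> core \<phi>" using r * by (simp add: m_def)
        have am: "a = r a \<otimes> m" using r(1) * by (simp add: m_def inv_cancel_right)
        \<comment> \<open>The core part m of a does not leave the fiber, so it can be absorbed into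
          the fiber member and recorded by some n in the core.\<close>
        have "conj m \<psi> \<in> fiber \<psi>"
          using conj_fiber_iff[OF _ \<psi>] m fiber_core[OF \<phi> *(2)] by simp
        then have "conj m \<psi> \<in> fiber \<phi>" using fiber_eq[OF \<phi> *(2)] by simp
        then obtain n where n: "n \<in> core \<phi>" "u n = conj m \<psi>"
          using u by (metis bij_betw_imp_surj_on imageE)
        define h where "h = r a \<otimes> n"
        have h: "h \<in> H" using r(1) * n by (simp add: h_def)
        have "inv h \<otimes> a = inv n \<otimes> m"
          using r(1)[OF *(1)] m n
          by (subst am) (simp add: h_def inv_mult_group m_assoc inv_cancel_left)
        then have "r h = r a" using m n by (intro r_eq[OF h *(1)]) simp
        then have "\<beta> h = conj (r a) (conj m \<psi>)"
          using r(1)[OF *(1)] n by (simp add: \<beta>_def h_def inv_cancel_left)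
        also have "\<dots> = conj (r a \<otimes> m) \<psi>" using r(1)[OF *(1)] m \<psi> by (simp add: conj_conj)
        also have "\<dots> = \<chi>" unfolding am[symmetric] *(3) ..
        finally show "\<chi> \<in> \<beta> ` H" using h by blast
      qed
    qed
  qed
  then show ?thesis unfolding eqpoll_def by blast
qed

text \<open>Closure under both moves makes \<Phi> a union of blocks, each equipotent to H.\<close>

theorem card_dvd_invariant:
  assumes "\<Phi> \<subseteq> homs"
    and conj: "\<And>a \<phi>. \<lbrakk>a \<in> H; \<phi> \<in> \<Phi>\<rbrakk> \<Longrightarrow> conj a \<phi> \<in> \<Phi>"
    and fiber: "\<And>\<phi>. \<phi> \<in> \<Phi> \<Longrightarrow> fiber \<phi> \<subseteq> \<Phi>"
  shows "card_dvd H \<Phi>"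
proof (rule card_dvd_if_partition[where R = block])
  fix \<phi> assume \<phi>: "\<phi> \<in> \<Phi>"
  show "\<phi> \<in> block \<phi>" "H \<approx> block \<phi>" using assms \<phi> block_refl block_eqpoll by blast+
  show "block \<phi> \<subseteq> \<Phi>" using conj fiber[OF \<phi>] by (auto simp: block_def)
  show "block \<chi> = block \<phi>" if "\<chi> \<in> block \<phi>" for \<chi> using assms \<phi> that block_eq by blast
qed

end

section \<open>Invariance of the condition on W, with H the commutator subgroup of A\<close>

theorem mainTheorem6:
  fixes G :: "('g, 'c) monoid_scheme" and F :: "('f, 'd) monoid_scheme"
  assumes "group G" and "group F"
    and "subgroup A G"
    and "subgroup W F"
    and "finitely_generated F"
    and "infinite (rcosets\<^bsub>F\<^esub> (derived F (carrier F)))"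
  shows "card_dvd (derived G A) (homs_onto F G W A)"
proof -
  interpret G: group G by fact
  interpret F: group F by fact
  interpret A: subgroup A G by fact
  interpret W: subgroup W F by fact
  obtain d t where dt: "d \<in> hom F integer_group" "t \<in> carrier F" "d t = 1"
    using F.infinite_abelianization_degree assms(5,6) by blast
  have A'A: "derived G A \<subseteq> A" using G.derived_incl assms(3) by blast
  interpret T: twisting G F d t "derived G A"
    by (intro twisting.intro twisting_axioms.intro assms(1,2) dt G.derived_is_subgroup A.subset)
  \<comment> \<open>Commutators have degree 0, as the integers are commutative.\<close>
  have W'K: "derived F W \<subseteq> T.K"
    unfolding derived_def
  proof (rule F.generate_subgroup_incl[OF _ T.K_subgroup])
    show "derived_set F W \<subseteq> T.K" by (auto simp: T.K_def simp del: T.K_carrier)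
  qed
  show ?thesis
  proof (rule T.card_dvd_invariant)
    show "homs_onto F G W A \<subseteq> T.homs" by (auto simp: homs_onto_def T.homs_def)
  next
    fix a \<phi> assume a: "a \<in> derived G A" and \<phi>: "\<phi> \<in> homs_onto F G W A"
    then have \<phi>h: "\<phi> \<in> T.homs" and \<phi>W: "\<phi> ` W = A" by (auto simp: homs_onto_def T.homs_def)
    \<comment> \<open>Conjugation by an element of A permutes A.\<close>
    have aA: "a \<in> A" using a A'A by blast
    have "T.conj a \<phi> ` W = (\<lambda>x. a \<otimes>\<^bsub>G\<^esub> x \<otimes>\<^bsub>G\<^esub> inv\<^bsub>G\<^esub> a) ` A"
      unfolding \<phi>W[symmetric] image_image by (intro image_cong) (auto simp: T.conj_def)
    also have "\<dots> = A"
    proof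
      show "(\<lambda>x. a \<otimes>\<^bsub>G\<^esub> x \<otimes>\<^bsub>G\<^esub> inv\<^bsub>G\<^esub> a) ` A \<subseteq> A" using aA by auto
      show "A \<subseteq> (\<lambda>x. a \<otimes>\<^bsub>G\<^esub> x \<otimes>\<^bsub>G\<^esub> inv\<^bsub>G\<^esub> a) ` A"
      proof
        fix x assume x: "x \<in> A"
        show "x \<in> (\<lambda>x. a \<otimes>\<^bsub>G\<^esub> x \<otimes>\<^bsub>G\<^esub> inv\<^bsub>G\<^esub> a) ` A"
          using x aA
          by (intro image_eqI[of _ _ "inv\<^bsub>G\<^esub> a \<otimes>\<^bsub>G\<^esub> x \<otimes>\<^bsub>G\<^esub> a"])
            (auto simp: G.m_assoc G.inv_cancel_right)
      qed
    qed
    finally show "T.conj a \<phi> \<in> homs_onto F G W A"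
      using T.conj_homs[OF _ \<phi>h, of a] aA by (auto simp: homs_onto_def T.homs_def)
  next
    fix \<phi> assume \<phi>: "\<phi> \<in> homs_onto F G W A"
    then have \<phi>h: "\<phi> \<in> T.homs" and \<phi>W: "\<phi> ` W = A" by (auto simp: homs_onto_def T.homs_def)
    interpret \<phi>: group_hom F G \<phi> using \<phi>h by (rule T.group_hom_homs)
    show "T.fiber \<phi> \<subseteq> homs_onto F G W A"
    proof
      fix \<psi> assume \<psi>: "\<psi> \<in> T.fiber \<phi>"
      then have \<psi>h: "\<psi> \<in> T.homs" by (rule T.fiber_homs)
      interpret \<psi>: group_hom F G \<psi> using \<psi>h by (rule T.group_hom_homs)
      \<comment> \<open>\<^term>\<open>\<psi>\<close> still covers the commutator subgroup of \<^term>\<open>A\<close>, because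
        commutators have degree 0, where \<^term>\<open>\<phi>\<close> and \<^term>\<open>\<psi>\<close> agree.\<close>
      have "derived G A = \<phi> ` derived F W" using \<phi>.derived_img[OF W.subset] \<phi>W by simp
      also have "\<dots> = \<psi> ` derived F W"
        using \<psi> W'K by (intro image_cong) (auto simp: T.fiber_def)
      also have "\<dots> \<subseteq> \<psi> ` W" using F.derived_incl[OF order_refl assms(4)] by blast
      finally have A'W: "derived G A \<subseteq> \<psi> ` W" .
      interpret \<psi>W: subgroup "\<psi> ` W" G by (rule \<psi>.subgroup_img_is_subgroup[OF assms(4)])
      \<comment> \<open>On W the two maps differ by elements of A', which lies both in A and in the
        image of W under \<psi>. Each inclusion between these two subgroups uses one of these
        facts.\<close>
      have n: "inv\<^bsub>G\<^esub> \<phi> w \<otimes>\<^bsub>G\<^esub> \<psi> w \<in> derived G A" if "w \<in> W" for w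
        using \<psi> that by (auto simp: T.fiber_def intro: T.core_H)
      have "\<psi> w \<in> A" if w: "w \<in> W" for w
      proof -
        have "\<psi> w = \<phi> w \<otimes>\<^bsub>G\<^esub> (inv\<^bsub>G\<^esub> \<phi> w \<otimes>\<^bsub>G\<^esub> \<psi> w)" using w by (simp add: G.inv_cancel_right)
        moreover have "\<phi> w \<in> A" using w \<phi>W by blast
        ultimately show ?thesis using n[OF w] A'A by (metis A.m_closed subsetD)
      qed
      moreover have "\<phi> w \<in> \<psi> ` W" if w: "w \<in> W" for w
      proof -
        have "\<phi> w = \<psi> w \<otimes>\<^bsub>G\<^esub> inv\<^bsub>G\<^esub> (inv\<^bsub>G\<^esub> \<phi> w \<otimes>\<^bsub>G\<^esub> \<psi> w)"
          using w by (simp add: G.inv_mult_group G.inv_cancel_right)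
        moreover have "inv\<^bsub>G\<^esub> (inv\<^bsub>G\<^esub> \<phi> w \<otimes>\<^bsub>G\<^esub> \<psi> w) \<in> \<psi> ` W" using n[OF w] A'W by blast
        ultimately show ?thesis using w \<psi>W.m_closed by (metis imageI)
      qed
      ultimately have "\<psi> ` W = A" using \<phi>W by blast
      then show "\<psi> \<in> homs_onto F G W A" using \<psi>h by (auto simp: homs_onto_def T.homs_def)
    qed
  qed
qed

end
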